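(* Let $k$ be a field, let $H$ be a numerical semigroup, and let $R=k[H]=\sum_{h\in H}kt^h\subseteq k[t]$ be its semigroup ring. Then for every maximal ideal $M$ of $R$ one has $\mu_R(M)\in\{1,2,\mu(H)\}$.
   Context: A numerical semigroup is a set $H=\langle a_1,\dots,a_v\rangle=\{\sum_{i=1}^v c_ia_i\mid 0\le c_i\in\mathbb Z\}$, where $v>0$ and $a_1,\dots,a_v$ are positive integers with $\operatorname{GCD}(a_1,\dots,a_v)=1$. $\mu_R(M)$ is the minimal number of generators of the $R$-module $M$, and $\mu(H)$ is the minimal number of generators of the semigroup $H$. *)

theory Defs
  imports
    "HOL-Algebra.Ideal"
    "HOL-Algebra.Module"
    "HOL-Computational_Algebra.Polynomial"
    "HOL-Library.Extended_Nat"
begin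

text \<open>
  The span is only meaningful for finite \<open>A\<close>; all uses below are guarded accordingly.
\<close>

definition semigroup_span :: "nat set \<Rightarrow> nat set" where
  "semigroup_span A = {\<Sum>a\<in>A. c a * a | c :: nat \<Rightarrow> nat. True}"

definition numerical_semigroup :: "nat set \<Rightarrow> bool" where
  "numerical_semigroup H \<longleftrightarrow>
    (\<exists>A. finite A \<and> A \<noteq> {} \<and> (\<forall>a\<in>A. 0 < a) \<and> Gcd A = 1 \<and> H = semigroup_span A)"

text \<open>
  Minimal numbers of generators are taken in \<^typ>\<open>enat\<close>, so that they are infinite
  exactly when there is no finite generating set (the infimum of the empty set being infinite).
\<close>

definition semigroup_mu :: "nat set \<Rightarrow> enat" where
  "semigroup_mu H = Inf {enat (card A) | A. finite A \<and> semigroup_span A = H}"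

definition semigroup_ring_carrier :: "nat set \<Rightarrow> 'k::field poly set" where
  "semigroup_ring_carrier H = {\<Sum>h\<in>A. monom (c h) h | A c. finite A \<and> A \<subseteq> H}"

definition semigroup_ring :: "nat set \<Rightarrow> 'k::field poly ring" where
  "semigroup_ring H =
    \<lparr>carrier = semigroup_ring_carrier H, monoid.mult = (*), one = 1, zero = 0, add = (+)\<rparr>"

definition module_generated_by :: "('a, 'r) ring_scheme \<Rightarrow> ('a, 'b, 'm) module_scheme \<Rightarrow> 'b set \<Rightarrow> bool" where
  "module_generated_by R M S \<longleftrightarrow>
    S \<subseteq> carrier M \<and> (\<forall>N. submodule N R M \<longrightarrow> S \<subseteq> N \<longrightarrow> N = carrier M)"

definition module_mu :: "('a, 'r) ring_scheme \<Rightarrow> ('a, 'b, 'm) module_scheme \<Rightarrow> enat" where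
  "module_mu R M = Inf {enat (card S) | S. finite S \<and> module_generated_by R M S}"

text \<open>
  An ideal as a module over its ring. The record of a module extends that of a ring;
  its fields \<open>mult\<close> and \<open>one\<close> play no role in the notion of a module.
\<close>

definition ideal_module :: "('a, 'r) ring_scheme \<Rightarrow> 'a set \<Rightarrow> ('a, 'a) module" where
  "ideal_module R I =
    \<lparr>carrier = I, monoid.mult = monoid.mult R, one = one R, zero = zero R, add = add R,
     module.smult = monoid.mult R\<rparr>"

end

theory Submission
  imports Defs
begin

text \<open>
  Let \<open>M\<^sub>0\<close> be the ideal of elements of \<open>R\<close> with vanishing constant term. The classes of
  the monomials \<open>t\<^sup>h\<close>, \<open>h\<close> an atom of \<open>H\<close>, form a basis of \<open>M\<^sub>0 / M\<^sub>0\<^sup>2\<close>, which gives \<open>\<mu>(M\<^sub>0) = \<mu>(H)\<close>.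
  Any other maximal ideal \<open>M\<close> contains some \<open>b\<close> with constant term 1. Let \<open>c\<close> be such that
  \<open>n \<in> H\<close> for all \<open>n \<ge> c\<close>. Then \<open>{p. t\<^sup>c p \<in> M}\<close> is an ideal of \<open>k[t]\<close>, generated by some \<open>f\<close>,
  and \<open>M\<close> is generated by \<open>b\<close> and \<open>t\<^sup>c f\<close>: some multiple of \<open>b\<close> has the form \<open>1 - t\<^bsup>2c\<^esup> r\<close>, and
  for \<open>g = f q \<in> M\<close> we have \<open>t\<^bsup>2c\<^esup> r g = (t\<^sup>c f) (t\<^sup>c r q)\<close> with \<open>t\<^sup>c r q \<in> R\<close>.
\<close>

section \<open>Numerical semigroups\<close>

lemma semigroup_span_zero: "0 \<in> semigroup_span A"
  unfolding semigroup_span_def by (auto intro: exI[of _ "\<lambda>_. 0"])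

lemma semigroup_span_add:
  assumes "x \<in> semigroup_span A" "y \<in> semigroup_span A"
  shows "x + y \<in> semigroup_span A"
proof -
  obtain c d where "x = (\<Sum>a\<in>A. c a * a)" "y = (\<Sum>a\<in>A. d a * a)"
    using assms unfolding semigroup_span_def by auto
  then have "x + y = (\<Sum>a\<in>A. (c a + d a) * a)"
    by (simp add: sum.distrib distrib_right)
  then show ?thesis
    unfolding semigroup_span_def by (intro CollectI exI[of _ "\<lambda>a. c a + d a"]) simp
qed

lemma semigroup_span_superset:
  assumes "finite A" "a \<in> A"
  shows "a \<in> semigroup_span A"
proof -
  have "(\<Sum>x\<in>A. (if x = a then 1 else 0) * x) = (\<Sum>x\<in>A. if x = a then x else 0)"
    by (rule sum.cong) auto
  also have "\<dots> = a"
    using assms by simp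
  finally show ?thesis
    unfolding semigroup_span_def
    by (intro CollectI exI[of _ "\<lambda>x. if x = a then 1 else 0"]) simp
qed

lemma semigroup_closed_mult:
  fixes H :: "nat set"
  assumes "0 \<in> H" "\<And>x y. x \<in> H \<Longrightarrow> y \<in> H \<Longrightarrow> x + y \<in> H" "x \<in> H"
  shows "n * x \<in> H"
  by (induction n) (auto simp: assms)

lemma semigroup_span_least:
  fixes H :: "nat set"
  assumes "0 \<in> H" "\<And>x y. x \<in> H \<Longrightarrow> y \<in> H \<Longrightarrow> x + y \<in> H" "A \<subseteq> H"
  shows "semigroup_span A \<subseteq> H"
proof -
  have "(\<Sum>a\<in>A. c a * a) \<in> H" for c :: "nat \<Rightarrow> nat"
    using assms(3)
  proof (induction A rule: infinite_finite_induct)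
    case (insert a A)
    then have "c a * a \<in> H"
      using semigroup_closed_mult[OF assms(1,2)] by auto
    with insert show ?case
      using assms(2) by auto
  \<comment> \<open>Sums over an infinite \<open>A\<close> are 0 by convention, so
    \<open>0 \<in> H\<close> settles that case as well as the empty one.\<close>
  qed (use assms(1) in auto)
  then show ?thesis
    unfolding semigroup_span_def by auto
qed

lemma numerical_semigroup_zero: "numerical_semigroup H \<Longrightarrow> 0 \<in> H"
  unfolding numerical_semigroup_def using semigroup_span_zero by auto

lemma numerical_semigroup_add:
  "numerical_semigroup H \<Longrightarrow> x \<in> H \<Longrightarrow> y \<in> H \<Longrightarrow> x + y \<in> H"
  unfolding numerical_semigroup_def using semigroup_span_add by auto

lemma numerical_semigroup_mult:
  "numerical_semigroup H \<Longrightarrow> x \<in> H \<Longrightarrow> n * x \<in> H"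
  by (rule semigroup_closed_mult[OF numerical_semigroup_zero numerical_semigroup_add])

section \<open>Consecutive elements and the conductor\<close>

lemma numerical_semigroup_consecutive:
  assumes "numerical_semigroup H"
  shows "\<exists>x. x \<in> H \<and> Suc x \<in> H"
proof -
  note mult = numerical_semigroup_mult[OF assms] and add = numerical_semigroup_add[OF assms]
  obtain A where A: "finite A" "A \<noteq> {}" "\<forall>a\<in>A. 0 < a" "Gcd A = 1" "H = semigroup_span A"
    using assms unfolding numerical_semigroup_def by auto
  then have AH: "A \<subseteq> H"
    using semigroup_span_superset by auto
  \<comment> \<open>the smallest positive difference of two elements of \<open>H\<close> divides every generator\<close>
  define P where "P d \<longleftrightarrow> 0 < d \<and> (\<exists>x. x \<in> H \<and> x + d \<in> H)" for d
  obtain a where "a \<in> A"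
    using A by auto
  then have "P a"
    unfolding P_def using A AH numerical_semigroup_zero[OF assms]
    by (intro conjI exI[of _ 0]) auto
  define d where "d = (LEAST d. P d)"
  have "P d"
    unfolding d_def by (rule LeastI) fact
  then obtain x where x: "0 < d" "x \<in> H" "x + d \<in> H"
    unfolding P_def by auto
  have least: "d \<le> e" if "P e" for e
    unfolding d_def using that by (rule Least_le)
  have "d dvd a" if "a \<in> A" for a
  proof (rule ccontr)
    assume "\<not> d dvd a"
    then have r: "0 < a mod d"
      by (simp add: dvd_eq_mod_eq_0)
    \<comment> \<open>Both \<open>(a div d) * (x + d)\<close> and its sum with the remainder lie in
      \<open>H\<close>, so a nonzero remainder would be a positive difference smaller than
      \<open>d\<close>.\<close>
    have "(a div d) * (x + d) + a mod d = (a div d) * x + a"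
      by (simp add: algebra_simps)
    also have "\<dots> \<in> H"
      using AH that x by (intro add mult) auto
    finally have "P (a mod d)"
      unfolding P_def using r mult[OF x(3)] by blast
    with least have "d \<le> a mod d"
      by blast
    with mod_less_divisor[OF x(1), of a] show False
      by linarith
  qed
  then have "d dvd Gcd A"
    by (rule Gcd_greatest)
  with A(4) have "d = 1"
    by simp
  with x show ?thesis
    by auto
qed

text \<open>Let \<open>x\<close> and \<open>x + 1\<close> lie in \<open>H\<close>. For
  \<open>x > 0\<close> and \<open>n \<ge> x * x\<close>, division by \<open>x\<close> gives a
  quotient \<open>q\<close> and a remainder \<open>s\<close> with \<open>s < x \<le> q\<close>,
  hence \<open>n = (q - s) * x + s * (x + 1)\<close>.\<close>

lemma numerical_semigroup_conductor:
  assumes "numerical_semigroup H"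
  shows "\<exists>c. \<forall>n\<ge>c. n \<in> H"
proof -
  note mult = numerical_semigroup_mult[OF assms] and add = numerical_semigroup_add[OF assms]
  obtain x where x: "x \<in> H" "Suc x \<in> H"
    using numerical_semigroup_consecutive[OF assms] by auto
  have "n \<in> H" if n: "n \<ge> x * x" for n
  proof (cases "x = 0")
    case True
    then show ?thesis
      using mult[OF x(2), of n] by simp
  next
    case False
    then have "x \<le> n div x"
      using div_le_mono[OF n, of x] by simp
    moreover have "n mod x < x"
      using False by simp
    ultimately obtain e where e: "n div x = n mod x + e"
      by (metis le_trans less_imp_le nat_le_iff_add)
    have "n = (n div x) * x + n mod x"
      by simp
    also have "\<dots> = e * x + (n mod x) * Suc x"
      unfolding e by (simp add: algebra_simps)
    also have "\<dots> \<in> H"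
      using x by (intro add mult)
    finally show ?thesis .
  qed
  then show ?thesis
    by blast
qed

section \<open>Atoms and the minimal number of generators of the semigroup\<close>

definition atoms :: "nat set \<Rightarrow> nat set" where
  "atoms H = {h \<in> H. h \<noteq> 0 \<and> (\<forall>x\<in>H. \<forall>y\<in>H. h = x + y \<longrightarrow> x = 0 \<or> y = 0)}"

lemma atomD: "x + y \<in> atoms H \<Longrightarrow> x \<in> H \<Longrightarrow> y \<in> H \<Longrightarrow> x = 0 \<or> y = 0"
  unfolding atoms_def by blast

text \<open>Some nonzero generator \<open>a\<close> occurs in a representation of the atom;
  splitting off one copy of it writes the atom as \<open>a + y\<close> with both summands in the
  span, which forces \<open>y = 0\<close>.\<close>

lemma atoms_subset_generators:
  assumes "finite A"
  shows "atoms (semigroup_span A) \<subseteq> A"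
proof
  fix h assume h: "h \<in> atoms (semigroup_span A)"
  then obtain c where c: "h = (\<Sum>a\<in>A. c a * a)"
    unfolding atoms_def semigroup_span_def by auto
  have "h \<noteq> 0"
    using h unfolding atoms_def by auto
  then obtain a where a: "a \<in> A" "c a * a \<noteq> 0"
    using c by (meson sum.neutral)
  define y where "y = (c a - 1) * a + (\<Sum>x\<in>A - {a}. c x * x)"
  have "h = c a * a + (\<Sum>x\<in>A - {a}. c x * x)"
    unfolding c using assms a by (simp add: sum.remove)
  also have "c a * a = a + (c a - 1) * a"
    using a by (cases "c a") auto
  finally have hy: "h = a + y"
    unfolding y_def by simp
  \<comment> \<open>Lowering the coefficient of \<open>a\<close> by one gives a representation of
    \<open>y\<close>.\<close>
  have "(\<Sum>x\<in>A - {a}. (c(a := c a - 1)) x * x) = (\<Sum>x\<in>A - {a}. c x * x)"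
    by (rule sum.cong) auto
  then have "y = (\<Sum>x\<in>A. (c(a := c a - 1)) x * x)"
    unfolding y_def using sum.remove[OF assms a(1), of "\<lambda>x. (c(a := c a - 1)) x * x"] by simp
  then have "y \<in> semigroup_span A"
    unfolding semigroup_span_def by blast
  moreover have "a \<in> semigroup_span A"
    using semigroup_span_superset assms a by auto
  ultimately have "a = 0 \<or> y = 0"
    using h hy unfolding atoms_def by blast
  with a hy show "h \<in> A"
    by auto
qed

lemma finite_atoms: "numerical_semigroup H \<Longrightarrow> finite (atoms H)"
  unfolding numerical_semigroup_def by (auto intro: finite_subset[OF atoms_subset_generators])

text \<open>Strong induction: a nonzero non-atom splits into two nonzero, hence smaller, elements,
  and an atom can be split off one of them. Peeling off a single atom is also the form needed to
  factor monomials.\<close>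

lemma atom_decomposition:
  assumes H: "numerical_semigroup H" and "h \<in> H" "h \<noteq> 0"
  shows "\<exists>e\<in>atoms H. \<exists>x\<in>H. h = e + x"
  using assms(2,3)
proof (induction h rule: less_induct)
  case (less h)
  show ?case
  proof (cases "h \<in> atoms H")
    case True
    then show ?thesis
      using numerical_semigroup_zero[OF H] by force
  next
    case False
    then obtain x y where xy: "x \<in> H" "y \<in> H" "h = x + y" "x \<noteq> 0" "y \<noteq> 0"
      using less.prems unfolding atoms_def by auto
    then have "x < h"
      by simp
    then obtain e z where "e \<in> atoms H" "z \<in> H" "x = e + z"
      using less.IH[of x] xy(1,4) by blast
    with xy(2,3) have "e \<in> atoms H" "z + y \<in> H" "h = e + (z + y)"
      by (simp_all add: numerical_semigroup_add[OF H])
    then show ?thesis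
      by blast
  qed
qed

lemma semigroup_span_atoms:
  assumes H: "numerical_semigroup H"
  shows "semigroup_span (atoms H) = H"
proof
  show "semigroup_span (atoms H) \<subseteq> H"
    using numerical_semigroup_zero[OF H] numerical_semigroup_add[OF H]
    by (rule semigroup_span_least) (auto simp: atoms_def)
  show "H \<subseteq> semigroup_span (atoms H)"
  proof
    fix h assume "h \<in> H"
    then show "h \<in> semigroup_span (atoms H)"
    proof (induction h rule: less_induct)
      case (less h)
      show ?case
      proof (cases "h = 0")
        case True
        then show ?thesis
          using semigroup_span_zero by simp
      next
        case False
        then obtain e x where ex: "e \<in> atoms H" "x \<in> H" "h = e + x"
          using atom_decomposition[OF H less.prems] by auto
        then have "0 < e"
          unfolding atoms_def by auto
        with ex have "x \<in> semigroup_span (atoms H)"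
          using less.IH by auto
        with ex show ?thesis
          using semigroup_span_add semigroup_span_superset[OF finite_atoms[OF H]] by auto
      qed
    qed
  qed
qed

text \<open>Both \<open>semigroup_mu\<close> and \<open>module_mu\<close> are infima of this shape;
  each is thereby reduced to a set attaining the value and a lower bound.\<close>

lemma Inf_enat_card_eqI:
  assumes "finite S" "P S" "card S = n" "\<And>T. finite T \<Longrightarrow> P T \<Longrightarrow> n \<le> card T"
  shows "Inf {enat (card S) | S. finite S \<and> P S} = enat n"
proof (rule antisym)
  show "Inf {enat (card S) | S. finite S \<and> P S} \<le> enat n"
    using assms(1-3) by (intro Inf_lower) auto
  show "enat n \<le> Inf {enat (card S) | S. finite S \<and> P S}"
    by (rule Inf_greatest) (use assms(4) in force)
qed

lemma semigroup_mu_eq_card_atoms: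
  assumes H: "numerical_semigroup H"
  shows "semigroup_mu H = enat (card (atoms H))"
  unfolding semigroup_mu_def
proof (rule Inf_enat_card_eqI)
  fix A assume "finite A" "semigroup_span A = H"
  then show "card (atoms H) \<le> card A"
    using atoms_subset_generators card_mono by metis
qed (simp_all add: finite_atoms[OF H] semigroup_span_atoms[OF H])

section \<open>The semigroup ring and its ideals\<close>

text \<open>This support criterion replaces explicit sums of monomials in the later membership
  proofs.\<close>

lemma semigroup_ring_carrier_iff:
  "p \<in> semigroup_ring_carrier H \<longleftrightarrow> (\<forall>n. coeff p n \<noteq> 0 \<longrightarrow> n \<in> H)"
proof
  assume "p \<in> semigroup_ring_carrier H"
  then obtain A c where A: "finite A" "A \<subseteq> H" "p = (\<Sum>h\<in>A. monom (c h) h)"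
    unfolding semigroup_ring_carrier_def by auto
  have "coeff p n = (if n \<in> A then c n else 0)" for n
    unfolding A(3) using A(1) by (simp add: coeff_sum coeff_monom)
  with A show "\<forall>n. coeff p n \<noteq> 0 \<longrightarrow> n \<in> H"
    by auto
next
  assume *: "\<forall>n. coeff p n \<noteq> 0 \<longrightarrow> n \<in> H"
  define A where "A = {n. coeff p n \<noteq> 0}"
  have "A \<subseteq> {..degree p}"
    unfolding A_def using le_degree by auto
  then have "finite A" "(\<Sum>h\<in>A. monom (coeff p h) h) = (\<Sum>h\<le>degree p. monom (coeff p h) h)"
    unfolding A_def by (auto intro: finite_subset sum.mono_neutral_left)
  then have "p = (\<Sum>h\<in>A. monom (coeff p h) h)"
    by (simp add: poly_as_sum_of_monoms)
  moreover have "A \<subseteq> H"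
    using * unfolding A_def by auto
  ultimately show "p \<in> semigroup_ring_carrier H"
    unfolding semigroup_ring_carrier_def using \<open>finite A\<close> by blast
qed

lemma semigroup_ring_simps [simp]:
  "carrier (semigroup_ring H) = semigroup_ring_carrier H"
  "x \<otimes>\<^bsub>semigroup_ring H\<^esub> y = x * y"
  "x \<oplus>\<^bsub>semigroup_ring H\<^esub> y = x + y"
  "\<zero>\<^bsub>semigroup_ring H\<^esub> = 0"
  "\<one>\<^bsub>semigroup_ring H\<^esub> = 1"
  by (simp_all add: semigroup_ring_def)

lemma semigroup_ring_carrier_add:
  assumes "p \<in> semigroup_ring_carrier H" "q \<in> semigroup_ring_carrier H"
  shows "p + q \<in> semigroup_ring_carrier H"
  unfolding semigroup_ring_carrier_iff
proof (intro allI impI)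
  fix n assume "coeff (p + q) n \<noteq> 0"
  then have "coeff p n \<noteq> 0 \<or> coeff q n \<noteq> 0"
    by auto
  with assms show "n \<in> H"
    unfolding semigroup_ring_carrier_iff by auto
qed

lemma semigroup_ring_carrier_uminus:
  "p \<in> semigroup_ring_carrier H \<Longrightarrow> - p \<in> semigroup_ring_carrier H"
  by (simp add: semigroup_ring_carrier_iff)

lemma semigroup_ring_carrier_mult:
  assumes H: "numerical_semigroup H"
    and "p \<in> semigroup_ring_carrier H" "q \<in> semigroup_ring_carrier H"
  shows "p * q \<in> semigroup_ring_carrier H"
  unfolding semigroup_ring_carrier_iff
proof (intro allI impI)
  fix n assume "coeff (p * q) n \<noteq> 0"
  then obtain i where "i \<le> n" "coeff p i * coeff q (n - i) \<noteq> 0"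
    unfolding coeff_mult using sum.neutral by (metis (no_types, lifting) atMost_iff)
  then have "i \<in> H" "n - i \<in> H"
    using assms unfolding semigroup_ring_carrier_iff by auto
  with \<open>i \<le> n\<close> show "n \<in> H"
    using numerical_semigroup_add[OF H, of i "n - i"] by simp
qed

lemma monom_in_semigroup_ring_carrier:
  "h \<in> H \<Longrightarrow> monom c h \<in> semigroup_ring_carrier H"
  by (simp add: semigroup_ring_carrier_iff coeff_monom)

lemma const_in_semigroup_ring_carrier:
  "numerical_semigroup H \<Longrightarrow> [:c:] \<in> semigroup_ring_carrier H"
  using monom_in_semigroup_ring_carrier[OF numerical_semigroup_zero] by (simp add: monom_0)

text \<open>All exponents of the product are at least \<open>c\<close>, although \<open>p\<close> is
  an arbitrary polynomial. This is how facts about k[t] are carried back to the ring.\<close>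

lemma monom_mult_in_semigroup_ring_carrier:
  assumes "\<forall>n\<ge>c. n \<in> H"
  shows "monom 1 c * p \<in> semigroup_ring_carrier H"
  using assms by (auto simp: semigroup_ring_carrier_iff coeff_monom_mult)

section \<open>Ideals and submodules as closure conditions on polynomials\<close>

lemma ideal_semigroup_ringD:
  assumes "ideal I (semigroup_ring H)"
  shows "I \<subseteq> semigroup_ring_carrier H" "0 \<in> I"
    "\<And>x y. x \<in> I \<Longrightarrow> y \<in> I \<Longrightarrow> x + y \<in> I"
    "\<And>r x. r \<in> semigroup_ring_carrier H \<Longrightarrow> x \<in> I \<Longrightarrow> r * x \<in> I"
proof -
  interpret ideal I "semigroup_ring H" by fact
  show "I \<subseteq> semigroup_ring_carrier H" "0 \<in> I"
    "\<And>x y. x \<in> I \<Longrightarrow> y \<in> I \<Longrightarrow> x + y \<in> I"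
    "\<And>r x. r \<in> semigroup_ring_carrier H \<Longrightarrow> x \<in> I \<Longrightarrow> r * x \<in> I"
    using a_subset additive_subgroup.zero_closed[OF is_additive_subgroup]
      additive_subgroup.a_closed[OF is_additive_subgroup] I_l_closed by auto
qed

text \<open>The inverse of a record is a definite description, here identified with
  \<open>-\<close>. A general \<open>G\<close> covers both the ring and the module record.\<close>

lemma m_inv_add_monoid_eq_uminus:
  fixes x :: "'a::ab_group_add"
  assumes "\<And>x y. x \<oplus>\<^bsub>G\<^esub> y = x + y" "\<zero>\<^bsub>G\<^esub> = 0" "- x \<in> carrier G"
  shows "inv\<^bsub>add_monoid G\<^esub> x = - x"
  unfolding m_inv_def
proof (rule the_equality)
  show "y = - x" if "y \<in> carrier (add_monoid G) \<and>
      x \<otimes>\<^bsub>add_monoid G\<^esub> y = \<one>\<^bsub>add_monoid G\<^esub> \<and> y \<otimes>\<^bsub>add_monoid G\<^esub> x = \<one>\<^bsub>add_monoid G\<^esub>" for y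
    using that by (simp add: assms eq_neg_iff_add_eq_0)
qed (use assms in simp)

text \<open>Closure under additive inverses follows from closure under scalars, since the constant
  -1 lies in the ring.\<close>

lemma submodule_ideal_module_iff:
  fixes H :: "nat set" and M :: "'k::field poly set"
  defines "R \<equiv> (semigroup_ring H :: 'k poly ring)"
  assumes H: "numerical_semigroup H"
  shows "submodule N R (ideal_module R M) \<longleftrightarrow> N \<subseteq> M \<and> 0 \<in> N \<and> (\<forall>x\<in>N. \<forall>y\<in>N. x + y \<in> N) \<and>
    (\<forall>r\<in>semigroup_ring_carrier H. \<forall>x\<in>N. r * x \<in> N)"
    (is "_ \<longleftrightarrow> ?rhs")
proof
  assume "submodule N R (ideal_module R M)"
  then interpret submodule N R "ideal_module R M" .
  show ?rhs
    using subset m_closed one_closed smult_closed unfolding R_def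
    by (auto simp: ideal_module_def)
next
  assume rhs: ?rhs
  have neg: "- x \<in> N" if "x \<in> N" for x
  proof -
    have "[:-1:] * x \<in> N"
      using rhs that const_in_semigroup_ring_carrier[OF H] by blast
    then show ?thesis
      by simp
  qed
  have "inv\<^bsub>add_monoid (ideal_module R M)\<^esub> x \<in> N" if "x \<in> N" for x
  proof -
    have "- x \<in> M"
      using rhs neg that by blast
    then have "inv\<^bsub>add_monoid (ideal_module R M)\<^esub> x = - x"
      by (intro m_inv_add_monoid_eq_uminus) (auto simp: ideal_module_def R_def)
    then show ?thesis
      using neg that by simp
  qed
  then show "submodule N R (ideal_module R M)"
    using rhs unfolding R_def
    by unfold_locales (auto simp: ideal_module_def)
qed

text \<open>The ring axioms enter as a hypothesis, supplied later by the given maximal ideal.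
  Negatives again come from the constant -1.\<close>

lemma ideal_semigroup_ringI:
  fixes I :: "'k::field poly set"
  assumes "ring (semigroup_ring H :: 'k poly ring)" and H: "numerical_semigroup H"
    and "I \<subseteq> semigroup_ring_carrier H" "0 \<in> I" "\<And>x y. x \<in> I \<Longrightarrow> y \<in> I \<Longrightarrow> x + y \<in> I"
    "\<And>r x. r \<in> semigroup_ring_carrier H \<Longrightarrow> x \<in> I \<Longrightarrow> r * x \<in> I"
  shows "ideal I (semigroup_ring H)"
proof -
  have neg: "- x \<in> I" if "x \<in> I" for x
    using assms(6)[OF const_in_semigroup_ring_carrier[OF H] that, of "- 1"] by simp
  have "inv\<^bsub>add_monoid (semigroup_ring H)\<^esub> x \<in> I" if "x \<in> I" for x
  proof -
    have "- x \<in> semigroup_ring_carrier H"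
      using neg that assms(3) by blast
    then have "inv\<^bsub>add_monoid (semigroup_ring H)\<^esub> x = - x"
      by (intro m_inv_add_monoid_eq_uminus) auto
    then show ?thesis
      using neg that by simp
  qed
  then have "subgroup I (add_monoid (semigroup_ring H))"
    using assms(3-5) by unfold_locales auto
  with assms(1) show ?thesis
  proof (rule idealI)
    fix a x assume "a \<in> I" "x \<in> carrier (semigroup_ring H :: 'k poly ring)"
    then have "x * a \<in> I"
      using assms(6) by simp
    then show "x \<otimes>\<^bsub>semigroup_ring H\<^esub> a \<in> I" "a \<otimes>\<^bsub>semigroup_ring H\<^esub> x \<in> I"
      by (simp_all add: mult.commute[of a x])
  qed
qed

section \<open>The maximal ideal at the origin\<close>

definition origin_ideal :: "nat set \<Rightarrow> 'k::field poly set" where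
  "origin_ideal H = {p \<in> semigroup_ring_carrier H. coeff p 0 = 0}"

lemma ideal_origin_ideal:
  assumes "ring (semigroup_ring H :: 'k::field poly ring)" "numerical_semigroup H"
  shows "ideal (origin_ideal H) (semigroup_ring H :: 'k poly ring)"
  using assms
  by (rule ideal_semigroup_ringI)
    (auto simp: origin_ideal_def semigroup_ring_carrier_add semigroup_ring_carrier_mult assms
      coeff_mult_0 semigroup_ring_carrier_iff[of 0])

text \<open>For nonzero \<open>h \<in> H\<close>, \<open>monom 1 h\<close> is a multiple of
  \<open>monom 1 e\<close> for some atom \<open>e\<close>, and the elements of the ideal are linear
  combinations of such monomials.\<close>

lemma origin_ideal_generated_by_atoms:
  fixes H :: "nat set"
  defines "R \<equiv> (semigroup_ring H :: 'k::field poly ring)"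
  assumes H: "numerical_semigroup H"
  shows "module_generated_by R (ideal_module R (origin_ideal H)) (monom 1 ` atoms H)"
  unfolding module_generated_by_def
proof (intro conjI allI impI)
  show "monom 1 ` atoms H \<subseteq> carrier (ideal_module R (origin_ideal H))"
    by (auto simp: ideal_module_def origin_ideal_def atoms_def monom_in_semigroup_ring_carrier)
next
  fix N assume N: "submodule N R (ideal_module R (origin_ideal H))" "monom 1 ` atoms H \<subseteq> N"
  have N': "N \<subseteq> origin_ideal H" "0 \<in> N" "\<And>x y. x \<in> N \<Longrightarrow> y \<in> N \<Longrightarrow> x + y \<in> N"
    "\<And>r x. r \<in> semigroup_ring_carrier H \<Longrightarrow> x \<in> N \<Longrightarrow> r * x \<in> N"
    using N(1)[unfolded R_def submodule_ideal_module_iff[OF H]] by simp_all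
  have mon: "monom c h \<in> N" if h: "h \<in> H" "h \<noteq> 0" for c h
  proof -
    obtain e x where ex: "e \<in> atoms H" "x \<in> H" "h = e + x"
      using atom_decomposition[OF H h] by auto
    then have "monom c x * monom 1 e \<in> N"
      using N(2) monom_in_semigroup_ring_carrier N'(4) by blast
    with ex show ?thesis
      by (simp add: mult_monom add.commute)
  qed
  have "p \<in> N" if "p \<in> origin_ideal H" for p
  proof -
    \<comment> \<open>A nonzero coefficient forces \<open>n\<close> to be a nonzero element of
      \<open>H\<close>, as \<open>mon\<close> requires; the other terms are 0.\<close>
    have *: "monom (coeff p n) n \<in> N" for n
      using that mon N'(2) unfolding origin_ideal_def semigroup_ring_carrier_iff
      by (cases "coeff p n = 0") auto
    have "(\<Sum>n\<in>A. monom (coeff p n) n) \<in> N" if "finite A" for A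
      using that by (induction A) (auto simp: N' *)
    then show ?thesis
      by (metis poly_as_sum_of_monoms finite_atMost)
  qed
  with N'(1) show "N = carrier (ideal_module R (origin_ideal H))"
    by (auto simp: ideal_module_def)
qed

lemma vector_space_poly: "vector_space (Polynomial.smult :: 'k::field \<Rightarrow> _)"
  by unfold_locales (simp_all add: smult_add_right smult_add_left)

text \<open>Truncation to the atom exponents, \<open>\<pi>\<close>, stands in for the quotient map
  onto \<open>M\<^sub>0 / M\<^sub>0\<^sup>2\<close>. Ring elements act on its image through their
  constant terms, so generation over the ring becomes spanning over k, where the independent atom
  monomials bound \<open>card S\<close> from below.\<close>

lemma card_atoms_le_generators_origin_ideal:
  fixes H :: "nat set" and S :: "'k::field poly set"
  defines "R \<equiv> (semigroup_ring H :: 'k poly ring)"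
  assumes H: "numerical_semigroup H" and "finite S"
    and S: "module_generated_by R (ideal_module R (origin_ideal H)) S"
  shows "card (atoms H) \<le> card S"
proof -
  interpret vs: vector_space "Polynomial.smult :: 'k \<Rightarrow> 'k poly \<Rightarrow> 'k poly"
    by (rule vector_space_poly)
  define \<pi> :: "'k poly \<Rightarrow> 'k poly" where "\<pi> p = (\<Sum>h\<in>atoms H. monom (coeff p h) h)" for p
  have coeff_\<pi>: "coeff (\<pi> p) n = (if n \<in> atoms H then coeff p n else 0)" for p n
    unfolding \<pi>_def using finite_atoms[OF H] by (simp add: coeff_sum coeff_monom)
  have \<pi>_add: "\<pi> (p + q) = \<pi> p + \<pi> q" for p q
    by (rule poly_eqI) (simp add: coeff_\<pi>)
  \<comment> \<open>\<open>\<pi>\<close> kills products of two elements of the ideal\<close>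
  have \<pi>_mult: "\<pi> (r * p) = Polynomial.smult (coeff r 0) (\<pi> p)"
    if r: "r \<in> semigroup_ring_carrier H" and p: "p \<in> origin_ideal H" for r p
  proof (rule poly_eqI)
    fix n
    have "coeff (r * p) n = coeff r 0 * coeff p n" if n: "n \<in> atoms H"
    proof -
      \<comment> \<open>A nonzero product would split the atom \<open>n\<close> into the elements
        \<open>i\<close> and \<open>n - i\<close> of \<open>H\<close>, both nonzero, the latter
        because \<open>p\<close> has no constant term.\<close>
      have "coeff r i * coeff p (n - i) = 0" if i: "i \<in> {..n} - {0}" for i
      proof (rule ccontr)
        assume "coeff r i * coeff p (n - i) \<noteq> 0"
        then have "i \<in> H" "n - i \<in> H" "n - i \<noteq> 0"
          using r p unfolding origin_ideal_def semigroup_ring_carrier_iff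
          by (auto intro!: gr0I)
        moreover have "n = i + (n - i)"
          using i by simp
        ultimately have "i = 0"
          using atomD[of i "n - i" H] n by auto
        with i show False
          by simp
      qed
      then have "(\<Sum>i\<le>n. coeff r i * coeff p (n - i)) = (\<Sum>i\<in>{0}. coeff r i * coeff p (n - i))"
        by (intro sum.mono_neutral_right) auto
      then show ?thesis
        by (simp add: coeff_mult)
    qed
    then show "coeff (\<pi> (r * p)) n = coeff (Polynomial.smult (coeff r 0) (\<pi> p)) n"
      by (simp add: coeff_\<pi>)
  qed
  \<comment> \<open>Generation is exploited through this submodule: it contains \<open>S\<close>, so
    it is the whole ideal, and the atom monomials, being fixed by \<open>\<pi>\<close>, lie in the
    span.\<close>
  define N where "N = {p \<in> origin_ideal H. \<pi> p \<in> vs.span (\<pi> ` S)}"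
  have SM: "S \<subseteq> origin_ideal H"
    using S unfolding module_generated_by_def by (simp add: ideal_module_def)
  have "submodule N R (ideal_module R (origin_ideal H))"
    unfolding R_def submodule_ideal_module_iff[OF H]
  proof (intro conjI ballI)
    have "\<pi> 0 = 0"
      unfolding \<pi>_def by simp
    then show "0 \<in> N"
      unfolding N_def origin_ideal_def
      by (simp add: vs.span_zero semigroup_ring_carrier_iff)
    show "x + y \<in> N" if "x \<in> N" "y \<in> N" for x y
      using that unfolding N_def origin_ideal_def
      by (simp add: \<pi>_add vs.span_add semigroup_ring_carrier_add)
    show "r * x \<in> N" if "r \<in> semigroup_ring_carrier H" "x \<in> N" for r x
      using that \<pi>_mult[of r x] unfolding N_def
      by (auto intro: vs.span_scale
          simp: origin_ideal_def semigroup_ring_carrier_mult[OF H] coeff_mult_0)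
  qed (auto simp: N_def)
  moreover have "S \<subseteq> N"
    using SM unfolding N_def by (auto intro: vs.span_base)
  ultimately have "N = origin_ideal H"
    using S unfolding module_generated_by_def by (simp add: ideal_module_def)
  have sub: "monom 1 ` atoms H \<subseteq> vs.span (\<pi> ` S)"
  proof
    fix p :: "'k poly" assume "p \<in> monom 1 ` atoms H"
    then obtain h where h: "h \<in> atoms H" "p = monom 1 h"
      by auto
    then have "p \<in> N"
      unfolding \<open>N = origin_ideal H\<close>
      by (simp add: origin_ideal_def atoms_def monom_in_semigroup_ring_carrier)
    moreover have "\<pi> p = p"
      using h by (intro poly_eqI) (auto simp: coeff_\<pi> coeff_monom)
    ultimately show "p \<in> vs.span (\<pi> ` S)"
      unfolding N_def by simp
  qed
  have indep: "vs.independent (monom 1 ` atoms H)"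
    unfolding vs.dependent_def
  proof
    assume "\<exists>p\<in>monom 1 ` atoms H. p \<in> vs.span (monom 1 ` atoms H - {p})"
    then obtain h where h: "h \<in> atoms H"
      "(monom 1 h :: 'k poly) \<in> vs.span (monom 1 ` atoms H - {monom 1 h})"
      by auto
    \<comment> \<open>The remaining monomials all have coefficient 0 at \<open>h\<close>, a
      condition that defines a subspace excluding \<open>monom 1 h\<close>.\<close>
    have "vs.span (monom 1 ` atoms H - {monom 1 h}) \<subseteq> {p. coeff p h = 0}"
      by (rule vs.span_minimal) (auto simp: vs.subspace_def)
    with h(2) show False
      by auto
  qed
  have "card (monom (1::'k) ` atoms H) \<le> card (\<pi> ` S)"
    using vs.independent_span_bound[OF _ indep sub] \<open>finite S\<close> by blast
  moreover have "card (monom (1::'k) ` atoms H) = card (atoms H)"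
    by (rule card_image) (auto simp: inj_on_def monom_eq_iff')
  ultimately show ?thesis
    using card_image_le[OF \<open>finite S\<close>, of \<pi>] by linarith
qed

lemma module_mu_origin_ideal:
  fixes H :: "nat set"
  defines "R \<equiv> (semigroup_ring H :: 'k::field poly ring)"
  assumes H: "numerical_semigroup H"
  shows "module_mu R (ideal_module R (origin_ideal H)) = semigroup_mu H"
  unfolding semigroup_mu_eq_card_atoms[OF H] module_mu_def
proof (rule Inf_enat_card_eqI)
  show "module_generated_by R (ideal_module R (origin_ideal H)) (monom 1 ` atoms H)"
    unfolding R_def by (rule origin_ideal_generated_by_atoms[OF H])
  show "card (monom (1::'k) ` atoms H) = card (atoms H)"
    by (rule card_image) (auto simp: inj_on_def monom_eq_iff')
  show "card (atoms H) \<le> card T"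
    if "finite T" "module_generated_by R (ideal_module R (origin_ideal H)) T" for T
    using card_atoms_le_generators_origin_ideal[OF H] that unfolding R_def by blast
qed (simp add: finite_atoms[OF H])

section \<open>The other maximal ideals\<close>

text \<open>Division with remainder: the remainder modulo a nonzero element of least degree lies in
  \<open>J\<close> again, so minimality forces it to be 0.\<close>

lemma poly_ideal_principal:
  fixes J :: "'k::field poly set"
  assumes add: "\<And>p q. p \<in> J \<Longrightarrow> q \<in> J \<Longrightarrow> p + q \<in> J"
    and mult: "\<And>p q. p \<in> J \<Longrightarrow> q * p \<in> J"
    and "b \<in> J" "b \<noteq> 0"
  shows "\<exists>f\<in>J. \<forall>g\<in>J. f dvd g"
proof -
  obtain f where f: "f \<in> J" "f \<noteq> 0" and
    min: "\<And>g. g \<in> J \<Longrightarrow> g \<noteq> 0 \<Longrightarrow> degree f \<le> degree g"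
    using ex_has_least_nat[of "\<lambda>p. p \<in> J \<and> p \<noteq> 0" b degree] assms(3,4) by blast
  have "f dvd g" if "g \<in> J" for g
  proof -
    have "g mod f = g + (- (g div f)) * f"
      by (simp add: minus_div_mult_eq_mod[symmetric])
    then have "g mod f \<in> J"
      using add mult f that by metis
    then have "g mod f = 0"
      using min degree_mod_less[OF f(2), of g] by fastforce
    then show ?thesis
      by (simp add: dvd_eq_mod_eq_0)
  qed
  with f show ?thesis
    by blast
qed

text \<open>Truncated geometric series: with \<open>m = 1 - b\<close>, the sum of
  \<open>m ^ i\<close> over \<open>i < n\<close> times \<open>b\<close> is \<open>1 - m ^ n\<close>,
  and \<open>monom 1 n\<close> divides \<open>m ^ n\<close> because \<open>m\<close> has no constant
  term. The cofactor \<open>r\<close> is merely a polynomial, while \<open>u\<close> stays in the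
  ring.\<close>

lemma inverse_modulo_monom:
  fixes b :: "'k::field poly"
  assumes H: "numerical_semigroup H" and b: "b \<in> semigroup_ring_carrier H" "coeff b 0 = 1"
  shows "\<exists>u\<in>semigroup_ring_carrier H. \<exists>r. u * b + monom 1 n * r = 1"
proof -
  define m where "m = 1 - b"
  have m: "m \<in> semigroup_ring_carrier H"
    using semigroup_ring_carrier_add[OF const_in_semigroup_ring_carrier[OF H, of 1]
        semigroup_ring_carrier_uminus[OF b(1)]]
    by (simp add: m_def one_pCons)
  have one: "1 \<in> (semigroup_ring_carrier H :: 'k poly set)"
    using const_in_semigroup_ring_carrier[OF H, of 1] by (simp add: one_pCons)
  have pow: "m ^ i \<in> semigroup_ring_carrier H" for i
    by (induction i) (simp_all add: one m semigroup_ring_carrier_mult[OF H])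
  define u where "u = (\<Sum>i<n. m ^ i)"
  have "(\<Sum>i<n. m ^ i) \<in> semigroup_ring_carrier H" for n
    by (induction n) (simp_all add: semigroup_ring_carrier_add pow semigroup_ring_carrier_iff[of 0])
  then have u: "u \<in> semigroup_ring_carrier H"
    unfolding u_def .
  have "monom 1 1 dvd m"
    using b(2) by (simp add: monom_1_dvd_iff' m_def)
  then have "monom 1 1 ^ n dvd m ^ n"
    by (rule dvd_power_same)
  then obtain r where "m ^ n = monom 1 n * r"
    by (auto simp: monom_power elim: dvdE)
  moreover have "u * b + m ^ n = 1"
    using one_diff_power_eq[of m n] unfolding u_def m_def by (simp add: algebra_simps)
  ultimately show ?thesis
    using u by metis
qed

lemma ideal_two_generators:
  fixes H :: "nat set" and M :: "'k::field poly set"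
  defines "R \<equiv> (semigroup_ring H :: 'k poly ring)"
  assumes H: "numerical_semigroup H" and "ideal M R" and b: "b \<in> M" "coeff b 0 = 1"
  shows "\<exists>a. module_generated_by R (ideal_module R M) {a, b}"
proof -
  note M = ideal_semigroup_ringD[OF \<open>ideal M R\<close>[unfolded R_def]]
  obtain c where c: "\<forall>n\<ge>c. n \<in> H"
    using numerical_semigroup_conductor[OF H] by auto
  note tc = monom_mult_in_semigroup_ring_carrier[OF c]
  \<comment> \<open>The exponent is twice \<open>c\<close>: one factor \<open>monom 1 c\<close>
    brings \<open>r\<close> into the ring, the other is absorbed into
    \<open>monom 1 c * g\<close>.\<close>
  obtain u r where ur: "u \<in> semigroup_ring_carrier H" "u * b + monom 1 (c + c) * r = 1"
    using inverse_modulo_monom[OF H _ b(2)] b(1) M(1) by blast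
  \<comment> \<open>This identity serves twice: to cancel \<open>monom 1 c\<close> modulo
    \<open>M\<close>, and to express elements of \<open>M\<close> by the two generators.\<close>
  have split: "g = (g * u) * b + (monom 1 c * r) * (monom 1 c * g)" for g
  proof -
    have "g = g * (u * b + (monom 1 c * monom 1 c) * r)"
      using ur by (simp add: mult_monom)
    then show ?thesis
      by (simp add: distrib_left mult_ac)
  qed
  \<comment> \<open>\<open>t\<^sup>c\<close> is a unit modulo \<open>M\<close>\<close>
  have cancel: "g \<in> M" if "g \<in> semigroup_ring_carrier H" "monom 1 c * g \<in> M" for g
    by (subst split) (intro M tc semigroup_ring_carrier_mult[OF H] that ur b)
  define J where "J = {p. monom 1 c * p \<in> M}"
  have "\<exists>f\<in>J. \<forall>g\<in>J. f dvd g"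
  proof (rule poly_ideal_principal)
    show "p + q \<in> J" if "p \<in> J" "q \<in> J" for p q
      using that M(3) unfolding J_def by (simp add: distrib_left)
    show "q * p \<in> J" if "p \<in> J" for p q
    proof -
      \<comment> \<open>As \<open>q\<close> is an arbitrary polynomial, it is multiplied in together
        with \<open>monom 1 c\<close>; the surplus factor is then cancelled.\<close>
      have "(monom 1 c * q) * (monom 1 c * p) \<in> M"
        using that tc M(4) unfolding J_def by blast
      then have "monom 1 c * (monom 1 c * (q * p)) \<in> M"
        by (simp add: mult_ac)
      then show ?thesis
        unfolding J_def using cancel tc by blast
    qed
    show "b \<in> J"
      unfolding J_def using b M(4) monom_in_semigroup_ring_carrier[of c H] c by auto
    show "b \<noteq> 0"
      using b(2) by auto
  qed
  then obtain f where f: "f \<in> J" "\<And>g. g \<in> J \<Longrightarrow> f dvd g"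
    by blast
  define a where "a = monom 1 c * f"
  have "a \<in> M"
    using f(1) unfolding a_def J_def by simp
  have "module_generated_by R (ideal_module R M) {a, b}"
    unfolding module_generated_by_def
  proof (intro conjI allI impI)
    show "{a, b} \<subseteq> carrier (ideal_module R M)"
      using b \<open>a \<in> M\<close> by (simp add: ideal_module_def)
    fix N assume N: "submodule N R (ideal_module R M)" "{a, b} \<subseteq> N"
    have N': "N \<subseteq> M" "\<And>x y. x \<in> N \<Longrightarrow> y \<in> N \<Longrightarrow> x + y \<in> N"
      "\<And>r x. r \<in> semigroup_ring_carrier H \<Longrightarrow> x \<in> N \<Longrightarrow> r * x \<in> N"
      using N(1)[unfolded R_def submodule_ideal_module_iff[OF H]] by simp_all
    have "g \<in> N" if "g \<in> M" for g
    proof -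
      have g: "g \<in> semigroup_ring_carrier H"
        using that M(1) by blast
      have "g \<in> J"
        unfolding J_def using that M(4) monom_in_semigroup_ring_carrier[of c H] c by auto
      then obtain q where q: "g = f * q"
        using f(2) by (auto elim: dvdE)
      \<comment> \<open>The spare \<open>monom 1 c\<close> is attached to \<open>r * q\<close>,
        whose factors are arbitrary polynomials; this makes the second summand of
        \<open>split\<close> a ring multiple of \<open>a\<close>.\<close>
      have "(monom 1 c * r) * (monom 1 c * g) = (monom 1 c * (r * q)) * a"
        unfolding q a_def by (simp add: mult_ac)
      moreover have "(monom 1 c * (r * q)) * a \<in> N"
        using N' N(2) tc by blast
      moreover have "(g * u) * b \<in> N"
        using N' N(2) semigroup_ring_carrier_mult[OF H g ur(1)] by blast
      ultimately show ?thesis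
        using N'(2) by (subst split) (simp only:)
    qed
    with N' show "N = carrier (ideal_module R M)"
      by (auto simp: ideal_module_def)
  qed
  then show ?thesis
    by blast
qed

text \<open>The pair of generators bounds the minimum by 2; an empty generating set would make
  \<open>M\<close> the zero ideal, contradicting \<open>b \<in> M\<close>.\<close>

lemma module_mu_in_1_2:
  fixes H :: "nat set" and M :: "'k::field poly set"
  defines "R \<equiv> (semigroup_ring H :: 'k poly ring)"
  assumes H: "numerical_semigroup H" and "ideal M R" and b: "b \<in> M" "coeff b 0 = 1"
  shows "module_mu R (ideal_module R M) \<in> {1, 2}"
proof -
  note M = ideal_semigroup_ringD[OF \<open>ideal M R\<close>[unfolded R_def]]
  let ?gen = "module_generated_by R (ideal_module R M)"
  obtain a where a: "?gen {a, b}"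
    using ideal_two_generators[OF H assms(3)[unfolded R_def] b] unfolding R_def by blast
  define n where "n = (LEAST n. \<exists>S. finite S \<and> ?gen S \<and> card S = n)"
  have ex: "\<exists>S. finite S \<and> ?gen S \<and> card S = card {a, b}"
    using a by (intro exI[of _ "{a, b}"]) simp
  obtain S where S: "finite S" "?gen S" "card S = n"
    using LeastI[of "\<lambda>n. \<exists>S. finite S \<and> ?gen S \<and> card S = n", OF ex, folded n_def] by (elim exE conjE)
  have "module_mu R (ideal_module R M) = enat n"
    unfolding module_mu_def using S
  proof (rule Inf_enat_card_eqI)
    show "n \<le> card T" if "finite T" "?gen T" for T
      unfolding n_def using that by (intro Least_le exI[of _ T]) simp
  qed
  moreover have "n \<le> 2"
  proof -
    have "n \<le> card {a, b}"
      unfolding n_def using ex by (rule Least_le)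
    \<comment> \<open>Only an inequality, since \<open>a\<close> and \<open>b\<close> may
      coincide.\<close>
    also have "\<dots> \<le> 2"
      by (simp add: card_insert_if)
    finally show ?thesis .
  qed
  moreover have "n \<noteq> 0"
  proof
    assume "n = 0"
    with S have "?gen {}"
      by simp
    moreover have "submodule {0} R (ideal_module R M)"
      unfolding R_def submodule_ideal_module_iff[OF H] using M(2) by auto
    ultimately have "{0} = M"
      unfolding module_generated_by_def by (auto simp: ideal_module_def)
    with b show False
      by auto
  qed
  ultimately have "n = 1 \<or> n = 2"
    by auto
  with \<open>module_mu R (ideal_module R M) = enat n\<close> show ?thesis
    by (auto simp: one_enat_def numeral_eq_enat)
qed

section \<open>Dichotomy: maximal ideals inside the ideal at the origin and the others\<close>

theorem mainTheorem2:
  fixes H :: "nat set" and R :: "'k::field poly ring" and M :: "'k poly set"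
  assumes "numerical_semigroup H"
    and "R = semigroup_ring H"
    and "maximalideal M R"
  shows "module_mu R (ideal_module R M) \<in> {1, 2, semigroup_mu H}"
proof (cases "M \<subseteq> origin_ideal H")
  case True
  interpret maximalideal M R by fact
  have "ideal (origin_ideal H) R"
    using ideal_origin_ideal assms(1) ring_axioms unfolding assms(2) by blast
  moreover have "origin_ideal H \<subseteq> carrier R"
    unfolding assms(2) origin_ideal_def by auto
  \<comment> \<open>The ideal at the origin is proper, so maximality of \<open>M\<close> turns the
    inclusion into an equality.\<close>
  moreover have "1 \<notin> (origin_ideal H :: 'k poly set)" "1 \<in> carrier R"
    using one_closed unfolding assms(2) origin_ideal_def by auto
  ultimately have "M = origin_ideal H"
    using I_maximal True by blast
  then show ?thesis
    using module_mu_origin_ideal[OF assms(1), where 'k = 'k] assms(2) by simp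
next
  case False
  interpret maximalideal M R by fact
  have M: "ideal M R"
    by (rule ideal_axioms)
  note D = ideal_semigroup_ringD[OF M[unfolded assms(2)]]
  obtain g where g: "g \<in> M" "coeff g 0 \<noteq> 0"
    using False D(1) unfolding origin_ideal_def by auto
  \<comment> \<open>Constants lie in the ring, so the constant term can be normalised to 1 inside
    \<open>M\<close>.\<close>
  define b where "b = [:inverse (coeff g 0):] * g"
  have "b \<in> M" "coeff b 0 = 1"
    using g D(4)[OF const_in_semigroup_ring_carrier[OF assms(1)]] unfolding b_def by auto
  then show ?thesis
    using module_mu_in_1_2[OF assms(1)] M unfolding assms(2) by blast
qed

end
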